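(* For $\lambda>0$ define $$P(0,\lambda):=\frac{\lambda}{e^{\lambda}}+\frac{\lambda^2}{2e^{\lambda}}+\sum_{i=3}^{\infty}\frac{2}{i}\,\frac{e^{-\lambda}\lambda^i}{i!},\qquad P(1,\lambda):=\frac{\lambda^2}{2e^{\lambda}}+\sum_{i=3}^{\infty}\frac{2}{i}\,\frac{e^{-\lambda}\lambda^i}{i!},$$ and, for real $r\ge 2$, $$P(r,\lambda):=\sum_{i\in\mathbb{Z},\ i>r}\frac{2(i-r)r}{i(i-1)}\,\frac{e^{-\lambda}\lambda^i}{i!}.$$ Let $\mathfrak{m}(\lambda)$ be a non-negative integer at which $P(\cdot,\lambda)$ reaches its maximum over the non-negative integers, and let $\mathbf{P}(\lambda):=P(\mathfrak{m}(\lambda),\lambda)$. Then $$\lim_{\lambda\to\infty}P\left(\frac{\lambda}{2},\lambda\right)=\lim_{\lambda\to\infty}P(\mathfrak{m}(\lambda),\lambda)=\lim_{\lambda\to\infty}\mathbf{P}(\lambda)=\frac12.$$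
   Context: For integer $r$, $P(r,\lambda)$ is the probability of success in the best-or-worst secretary problem (success means choosing the best or the worst object) when the number of objects is Poisson distributed with parameter $\lambda$, the first $r$ objects are rejected, and then the first object better than all, or worse than all, preceding ones is chosen. *)

theory Defs
  imports "HOL-Analysis.Analysis"
begin

definition poisson_weight :: "real \<Rightarrow> nat \<Rightarrow> real" where
  "poisson_weight l i = exp (- l) * l ^ i / fact i"

(* Only r = 0, r = 1 and real r \<ge> 2 are meaningful; at the other arguments the last branch
   is a junk value.  For r \<ge> 2 every integer i > r is positive, so the sum over the integers
   i > r is a sum over natural numbers. *)
definition P_succ :: "real \<Rightarrow> real \<Rightarrow> real" where
  "P_succ r l =
    (if r = 0 then
       l / exp l + l\<^sup>2 / (2 * exp l) + (\<Sum>\<^sub>\<infinity>i\<in>{3..}. 2 / real i * poisson_weight l i)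
     else if r = 1 then
       l\<^sup>2 / (2 * exp l) + (\<Sum>\<^sub>\<infinity>i\<in>{3..}. 2 / real i * poisson_weight l i)
     else
       (\<Sum>\<^sub>\<infinity>i\<in>{i. real i > r}.
          2 * (real i - r) * r / (real i * (real i - 1)) * poisson_weight l i))"

lemma poisson_weight_nonneg: "l \<ge> 0 \<Longrightarrow> poisson_weight l i \<ge> 0"
  by (simp add: poisson_weight_def)

lemma summable_poisson_weight: "summable (poisson_weight l)"
proof -
  have "summable (\<lambda>i. exp (- l) * (inverse (fact i) * l ^ i))"
    by (intro summable_mult summable_exp)
  then show ?thesis
    by (simp add: poisson_weight_def[abs_def] field_simps)
qed

lemma summable_on_poisson_weight: "l \<ge> 0 \<Longrightarrow> poisson_weight l summable_on A"
  using summable_on_subset_banach[of "poisson_weight l" UNIV A] norm_summable_imp_summable_on[of "poisson_weight l"]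
    summable_poisson_weight[of l] by (simp add: poisson_weight_nonneg)

lemma P_succ_coeff_bounds:
  assumes "n \<ge> 2" and "n < i"
  shows "0 \<le> 2 * (real i - real n) * real n / (real i * (real i - 1))"
    and "2 * (real i - real n) * real n / (real i * (real i - 1)) \<le> 2"
proof -
  have i: "real i > 0" "real i - 1 > 0" "real n \<le> real i - 1"
    using assms by auto
  show "0 \<le> 2 * (real i - real n) * real n / (real i * (real i - 1))"
    using i assms by (intro divide_nonneg_nonneg mult_nonneg_nonneg) auto
  have "(real i - real n) * real n \<le> real i * (real i - 1)"
    using i assms by (intro mult_mono) auto
  then show "2 * (real i - real n) * real n / (real i * (real i - 1)) \<le> 2"
    using i by (simp add: divide_le_eq mult.assoc del: right_diff_distrib_numeral)
qed

lemma P_succ_le_tail: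
  assumes "l > 0" and "n \<ge> 2"
  shows "P_succ (real n) l \<le> 2 * (\<Sum>i. poisson_weight l (i + n))"
proof -
  let ?f = "\<lambda>i. 2 * (real i - real n) * real n / (real i * (real i - 1)) * poisson_weight l i"
  have w: "(\<lambda>i. 2 * poisson_weight l i) summable_on A" for A
    using assms by (intro summable_on_cmult_right summable_on_poisson_weight) auto
  have b: "0 \<le> ?f i" "?f i \<le> 2 * poisson_weight l i" if "i \<in> {i. real i > real n}" for i
    using P_succ_coeff_bounds[of n i] that assms poisson_weight_nonneg[of l i]
    by (auto intro!: mult_right_mono mult_nonneg_nonneg simp del: times_divide_eq_left)
  have s: "?f summable_on {i. real i > real n}"
    by (rule summable_on_comparison_test[OF w[of "{i. real i > real n}"]]) (use b in auto)
  have "P_succ (real n) l = infsum ?f {i. real i > real n}"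
    using assms by (simp add: P_succ_def)
  also have "\<dots> \<le> (\<Sum>\<^sub>\<infinity>i\<in>{i. real i > real n}. 2 * poisson_weight l i)"
    by (rule infsum_mono[OF s w]) (use b in auto)
  also have "\<dots> \<le> (\<Sum>\<^sub>\<infinity>i\<in>{n..}. 2 * poisson_weight l i)"
    using assms by (intro infsum_mono2 w) (auto simp: poisson_weight_nonneg)
  also have "\<dots> = (\<Sum>\<^sub>\<infinity>i. 2 * poisson_weight l (i + n))"
  proof (rule infsum_reindex_bij_witness[of _ "\<lambda>i. i + n" "\<lambda>i. i - n"]) qed auto
  also have "\<dots> = (\<Sum>i. 2 * poisson_weight l (i + n))"
  proof (rule infsumI, rule sums_nonneg_imp_has_sum)
    show "(\<lambda>i. 2 * poisson_weight l (i + n)) sums (\<Sum>i. 2 * poisson_weight l (i + n))"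
      using summable_poisson_weight[of l]
      by (intro summable_sums summable_mult) (simp add: summable_iff_shift)
  qed (use assms in \<open>auto simp: poisson_weight_nonneg\<close>)
  also have "\<dots> = 2 * (\<Sum>i. poisson_weight l (i + n))"
    using summable_poisson_weight[of l] by (intro suminf_mult) (simp add: summable_iff_shift)
  finally show ?thesis .
qed

lemma P_succ_0_pos:
  assumes "l > 0"
  shows "P_succ 0 l > 0"
proof -
  have "0 \<le> (\<Sum>\<^sub>\<infinity>i\<in>{3..}. 2 / real i * poisson_weight l i)"
    using assms by (intro infsum_nonneg mult_nonneg_nonneg poisson_weight_nonneg) auto
  moreover have "0 < l / exp l" "0 \<le> l\<^sup>2 / (2 * exp l)"
    using assms by auto
  ultimately have "0 < l / exp l + l\<^sup>2 / (2 * exp l)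
      + (\<Sum>\<^sub>\<infinity>i\<in>{3..}. 2 / real i * poisson_weight l i)"
    by linarith
  then show ?thesis
    by (simp add: P_succ_def)
qed

lemma P_succ_maximum_attained:
  assumes "l > 0"
  shows "\<exists>m::nat. \<forall>n::nat. P_succ (real n) l \<le> P_succ (real m) l"
proof -
  have "(\<lambda>n. 2 * (\<Sum>i. poisson_weight l (i + n))) \<longlonglongrightarrow> 2 * 0"
    by (intro tendsto_mult tendsto_const suminf_exist_split2 summable_poisson_weight)
  then have "eventually (\<lambda>n. 2 * (\<Sum>i. poisson_weight l (i + n)) < P_succ 0 l) sequentially"
    using P_succ_0_pos[OF assms] by (intro order_tendstoD(2)) auto
  then obtain N where N: "\<And>n. n \<ge> N \<Longrightarrow> 2 * (\<Sum>i. poisson_weight l (i + n)) < P_succ 0 l"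
    by (auto simp: eventually_sequentially)
  let ?S = "(\<lambda>n. P_succ (real n) l) ` {..N + 2}"
  have "Max ?S \<in> ?S"
    by (intro Max_in) auto
  then obtain m where m: "P_succ (real m) l = Max ?S"
    by (metis (no_types, lifting) imageE)
  have le: "P_succ (real n) l \<le> P_succ (real m) l" if "n \<le> N + 2" for n
    unfolding m using that by (intro Max_ge) auto
  have "P_succ (real n) l \<le> P_succ (real m) l" for n
  proof (cases "n \<le> N + 2")
    case False
    then show ?thesis
      using P_succ_le_tail[OF assms, of n] N[of n] le[of 0] by simp
  qed (rule le)
  then show ?thesis
    by blast
qed

end

theory Submission
  imports Defs "HOL-Real_Asymp.Real_Asymp"
begin

text \<open>
  Let \<open>X\<close> be Poisson distributed with parameter \<open>l\<close>. For \<open>r \<ge> 2\<close> the number \<open>P_succ r l\<close> is the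
  expectation of the success probability \<open>c(r, X)\<close>, where \<open>c(r, x) = 2 (x - r) r / (x (x - 1))\<close> for
  \<open>x > r\<close> and \<open>c(r, x) = 0\<close> otherwise. Up to the factor \<open>x / (x - 1)\<close> this is \<open>2 t (1 - t)\<close> with
  \<open>t = r / x\<close>, a parabola whose maximum \<open>1/2\<close> is attained at \<open>t = 1/2\<close>. Two pointwise bounds turn
  this into estimates that need no concentration inequality, only explicit moments:

  \<^item> the parabola never exceeds \<open>1/2\<close>, and the correction factor costs at most \<open>1 / (x + 1)\<close>; since
    \<open>E (1 / (X + 1)) \<le> 1 / l\<close>, every strategy succeeds with probability at most \<open>1/2 + O(1 / l)\<close>
    (\<open>P_succ_le\<close>; the cases \<open>r = 0\<close> and \<open>r = 1\<close> are even \<open>O(1 / l)\<close>, see \<open>P_succ_0_le\<close>);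

  \<^item> completing the square shows that \<open>1/2 - (x - 2 r)\<^sup>2 / (2 r\<^sup>2)\<close> lies below \<open>c(r, x)\<close> for every \<open>x\<close>,
    because it is not positive where \<open>x \<le> r\<close>; since \<open>E (X - 2 r)\<^sup>2 = l + (l - 2 r)\<^sup>2\<close>, every \<open>r\<close> with
    \<open>r = l / 2 + O(1)\<close> succeeds with probability at least \<open>1/2 - O(1 / l)\<close> (\<open>P_succ_ge\<close>).

  For \<open>r = l / 2\<close> both bounds apply directly. For the optimal integer the lower bound is inherited from
  the integer part of \<open>l / 2\<close>.
\<close>

section \<open>Moments of the Poisson distribution\<close>

lemma has_sum_poisson_weight:
  assumes "l \<ge> 0"
  shows "(poisson_weight l has_sum 1) UNIV"
proof -
  have "(\<lambda>i. exp (- l) * (l ^ i /\<^sub>R fact i)) sums (exp (- l) * exp l)"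
    by (intro sums_mult exp_converges)
  then have "poisson_weight l sums 1"
    by (simp add: poisson_weight_def[abs_def] exp_minus field_simps)
  then show ?thesis
    using assms by (intro sums_nonneg_imp_has_sum poisson_weight_nonneg) auto
qed

lemma poisson_weight_Suc: "real (Suc i) * poisson_weight l (Suc i) = l * poisson_weight l i"
  by (simp add: poisson_weight_def field_simps del: of_nat_Suc)

text \<open>
  The Stein--Chen identity \<open>E (X g(X)) = l E (g(X + 1))\<close>. It yields all moments by recursion.
\<close>

lemma poisson_stein:
  assumes "((\<lambda>i. g (Suc i) * poisson_weight l i) has_sum s) UNIV"
  shows "((\<lambda>i. real i * g i * poisson_weight l i) has_sum (l * s)) UNIV"
proof -
  let ?h = "\<lambda>i. real i * g i * poisson_weight l i"
  have "?h (Suc i) = l * (g (Suc i) * poisson_weight l i)" for i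
  proof -
    have "?h (Suc i) = g (Suc i) * (real (Suc i) * poisson_weight l (Suc i))"
      by (simp only: mult_ac)
    then show ?thesis
      by (simp only: poisson_weight_Suc mult_ac)
  qed
  then have "?h \<circ> Suc = (\<lambda>i. l * (g (Suc i) * poisson_weight l i))"
    by (simp only: o_def)
  then have "(?h \<circ> Suc has_sum (l * s)) UNIV"
    using has_sum_cmult_right[OF assms, of l] by (simp only:)
  then have "(?h has_sum (l * s)) (range Suc)"
    by (subst has_sum_reindex) auto
  also have "?this \<longleftrightarrow> ?thesis"
    by (rule has_sum_cong_neutral) (auto simp: image_iff gr0_conv_Suc)
  finally show ?thesis .
qed

lemma has_sum_poisson_square_deviation:
  assumes "l \<ge> 0"
  shows "((\<lambda>i. (real i - a)\<^sup>2 * poisson_weight l i) has_sum (l + (l - a)\<^sup>2)) UNIV"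
proof -
  note E0 = has_sum_poisson_weight[OF assms]
  have E1: "((\<lambda>i. real i * poisson_weight l i) has_sum l) UNIV"
    using poisson_stein[of "\<lambda>_. 1" l 1] E0 by simp
  have "((\<lambda>i. real (Suc i) * poisson_weight l i) has_sum (l + 1)) UNIV"
    using has_sum_add[OF E1 E0] by (simp add: algebra_simps)
  then have E2: "((\<lambda>i. real i * real i * poisson_weight l i) has_sum (l * (l + 1))) UNIV"
    by (rule poisson_stein)
  have "((\<lambda>i. real i * real i * poisson_weight l i + (- 2 * a) * (real i * poisson_weight l i)
      + a\<^sup>2 * poisson_weight l i) has_sum (l * (l + 1) + (- 2 * a) * l + a\<^sup>2 * 1)) UNIV"
    by (intro has_sum_add has_sum_cmult_right E0 E1 E2)
  then show ?thesis
    by (simp add: algebra_simps power2_eq_square)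
qed

lemma poisson_inverse_Suc_bound:
  assumes "l > 0"
  shows "(\<lambda>i. poisson_weight l i / (real i + 1)) summable_on UNIV"
    and "(\<Sum>\<^sub>\<infinity>i. poisson_weight l i / (real i + 1)) \<le> 1 / l"
proof -
  \<comment> \<open>Dividing by \<open>i + 1\<close> moves the weight at \<open>i\<close> to the weight at \<open>i + 1\<close>, up to the factor \<open>l\<close>.\<close>
  have eq: "poisson_weight l i / (real i + 1) = 1 / l * poisson_weight l (Suc i)" for i
    using poisson_weight_Suc[of i l] assms by (simp add: field_simps)
  have summ: "poisson_weight l summable_on A" for A
    using assms by (intro summable_on_poisson_weight) auto
  have "poisson_weight l \<circ> Suc summable_on UNIV"
    using summ[of "range Suc"] by (subst (asm) summable_on_reindex) auto
  then show "(\<lambda>i. poisson_weight l i / (real i + 1)) summable_on UNIV"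
    unfolding eq by (intro summable_on_cmult_right) (simp add: o_def)
  have "(\<Sum>\<^sub>\<infinity>i. poisson_weight l (Suc i)) = infsum (poisson_weight l) (range Suc)"
    by (subst infsum_reindex) (auto simp: o_def)
  also have "\<dots> \<le> infsum (poisson_weight l) UNIV"
    using assms by (intro infsum_mono2 summ) (auto simp: poisson_weight_nonneg)
  also have "\<dots> = 1"
    using assms by (intro infsumI has_sum_poisson_weight) auto
  finally show "(\<Sum>\<^sub>\<infinity>i. poisson_weight l i / (real i + 1)) \<le> 1 / l"
    unfolding eq infsum_cmult_right' using assms by (simp add: divide_right_mono)
qed

section \<open>Pointwise bounds on the success probability\<close>

lemma success_coeff_le:
  fixes r x :: real
  assumes "x \<ge> 3"
  shows "2 * (x - r) * r / (x * (x - 1)) \<le> 1 / 2 + 1 / (x + 1)"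
proof -
  have "0 \<le> (x - 2 * r)\<^sup>2"
    by simp
  then have "2 * (x - r) * r \<le> x * x / 2"
    by (simp add: power2_eq_square algebra_simps)
  then have "2 * (x - r) * r / (x * (x - 1)) \<le> (x * x / 2) / (x * (x - 1))"
    using assms by (intro divide_right_mono) auto
  also have "\<dots> = 1 / 2 + 1 / (2 * (x - 1))"
    using assms by (simp add: field_simps)
  also have "1 / (2 * (x - 1)) \<le> 1 / (x + 1)"
    using assms by (intro divide_left_mono) auto
  finally show ?thesis
    by simp
qed

lemma success_coeff_ge:
  fixes r x :: real
  assumes "r < x" and "1 < x" and "0 < r"
  shows "1 / 2 - (x - 2 * r)\<^sup>2 / (2 * r\<^sup>2) \<le> 2 * (x - r) * r / (x * (x - 1))"
proof -
  have "(x - 2 * r)\<^sup>2 / (2 * x\<^sup>2) \<le> (x - 2 * r)\<^sup>2 / (2 * r\<^sup>2)"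
    using assms by (intro divide_left_mono mult_left_mono power_mono) auto
  then have "1 / 2 - (x - 2 * r)\<^sup>2 / (2 * r\<^sup>2) \<le> 1 / 2 - (x - 2 * r)\<^sup>2 / (2 * x\<^sup>2)"
    by simp
  also have "\<dots> = 2 * (x - r) * r / (x * x)"
    using assms by (simp add: power2_eq_square field_simps)
  also have "\<dots> \<le> 2 * (x - r) * r / (x * (x - 1))"
    using assms by (intro divide_left_mono mult_left_mono) auto
  finally show ?thesis .
qed

section \<open>Bounds on the expected success probability\<close>

lemma summable_on_P_succ:
  assumes "l > 0" and "r \<ge> 2"
  shows "(\<lambda>i. 2 * (real i - r) * r / (real i * (real i - 1)) * poisson_weight l i)
    summable_on {i. real i > r}"
proof (rule summable_on_comparison_test)
  show "(\<lambda>i. 2 * poisson_weight l i) summable_on {i. real i > r}"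
    using assms by (intro summable_on_cmult_right summable_on_poisson_weight) auto
next
  fix i assume "i \<in> {i. real i > r}"
  then have i: "real i > r" "real i \<ge> 3"
    using assms by auto
  have "2 * (real i - r) * r / (real i * (real i - 1)) \<le> 1 / 2 + 1 / (real i + 1)"
    by (rule success_coeff_le) (rule i)
  also have "\<dots> \<le> 2"
    using i by (simp add: field_simps)
  finally show "2 * (real i - r) * r / (real i * (real i - 1)) * poisson_weight l i
      \<le> 2 * poisson_weight l i"
    using assms by (intro mult_right_mono poisson_weight_nonneg) auto
  show "0 \<le> 2 * (real i - r) * r / (real i * (real i - 1)) * poisson_weight l i"
    using i assms by (intro mult_nonneg_nonneg divide_nonneg_nonneg poisson_weight_nonneg) auto
qed

lemma P_succ_le:
  assumes "l > 0" and "r \<ge> 2"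
  shows "P_succ r l \<le> 1 / 2 + 1 / l"
proof -
  let ?g = "\<lambda>i. 1 / 2 * poisson_weight l i + poisson_weight l i / (real i + 1)"
  have w: "(\<lambda>i. 1 / 2 * poisson_weight l i) summable_on UNIV"
    using assms by (intro summable_on_cmult_right summable_on_poisson_weight) auto
  note v = poisson_inverse_Suc_bound[OF assms(1)]
  have "P_succ r l = (\<Sum>\<^sub>\<infinity>i\<in>{i. real i > r}.
      2 * (real i - r) * r / (real i * (real i - 1)) * poisson_weight l i)"
    using assms by (simp add: P_succ_def)
  also have "\<dots> \<le> infsum ?g UNIV"
  proof (rule infsum_mono_neutral[OF summable_on_P_succ[OF assms] summable_on_add[OF w v(1)]])
    fix i assume "i \<in> {i. real i > r} \<inter> UNIV"
    then have "real i \<ge> 3"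
      using assms by auto
    then have "2 * (real i - r) * r / (real i * (real i - 1)) * poisson_weight l i
        \<le> (1 / 2 + 1 / (real i + 1)) * poisson_weight l i"
      using assms by (intro mult_right_mono success_coeff_le poisson_weight_nonneg) auto
    then show "2 * (real i - r) * r / (real i * (real i - 1)) * poisson_weight l i \<le> ?g i"
      by (simp add: algebra_simps)
  qed (use assms in \<open>auto simp: poisson_weight_nonneg\<close>)
  also have "\<dots> = 1 / 2 * infsum (poisson_weight l) UNIV
      + (\<Sum>\<^sub>\<infinity>i. poisson_weight l i / (real i + 1))"
    unfolding infsum_add[OF w v(1)] infsum_cmult_right' ..
  also have "infsum (poisson_weight l) UNIV = 1"
    using assms by (intro infsumI has_sum_poisson_weight) auto
  finally show ?thesis
    using v(2) by simp
qed

lemma P_succ_ge: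
  assumes "l > 0" and "r \<ge> 2"
  shows "1 / 2 - (l + (l - 2 * r)\<^sup>2) / (2 * r\<^sup>2) \<le> P_succ r l"
proof -
  let ?c = "\<lambda>i. 2 * (real i - r) * r / (real i * (real i - 1)) * poisson_weight l i"
  let ?q = "\<lambda>i. 1 / 2 * poisson_weight l i
    + - (1 / (2 * r\<^sup>2)) * ((real i - 2 * r)\<^sup>2 * poisson_weight l i)"
  have q_eq: "?q i = (1 / 2 - (real i - 2 * r)\<^sup>2 / (2 * r\<^sup>2)) * poisson_weight l i" for i
    by (simp add: algebra_simps)
  have q: "(?q has_sum (1 / 2 * 1 + - (1 / (2 * r\<^sup>2)) * (l + (l - 2 * r)\<^sup>2))) UNIV"
    using assms
    by (intro has_sum_add has_sum_cmult_right has_sum_poisson_weight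
        has_sum_poisson_square_deviation) auto
  have c: "(?c has_sum infsum ?c {i. real i > r}) {i. real i > r}"
    by (intro has_sum_infsum summable_on_P_succ assms)
  have "1 / 2 * 1 + - (1 / (2 * r\<^sup>2)) * (l + (l - 2 * r)\<^sup>2) \<le> infsum ?c {i. real i > r}"
  proof (rule has_sum_mono_neutral[OF q c])
    fix i assume "i \<in> UNIV \<inter> {i. real i > r}"
    then show "?q i \<le> ?c i"
      unfolding q_eq using assms
      by (intro mult_right_mono success_coeff_ge poisson_weight_nonneg) auto
  next
    \<comment> \<open>Below \<open>r\<close> the minorant is not positive, because \<open>2 r - i \<ge> r\<close> there.\<close>
    fix i assume "i \<in> UNIV - {i. real i > r}"
    then have "r\<^sup>2 \<le> (2 * r - real i)\<^sup>2"
      using assms by (intro power_mono) auto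
    then have "1 / 2 - (real i - 2 * r)\<^sup>2 / (2 * r\<^sup>2) \<le> 0"
      using assms by (simp add: power2_commute[of "real i"] field_simps)
    then show "?q i \<le> 0"
      unfolding q_eq using assms by (intro mult_nonpos_nonneg poisson_weight_nonneg) auto
  qed auto
  then show ?thesis
    using assms by (simp add: P_succ_def)
qed

text \<open>
  A candidate accepted without observing anything is the best or the worst only with probability of
  order \<open>1 / X\<close>. The constant \<open>3\<close> makes \<open>3 / (i + 1)\<close> dominate the coefficients of all weights,
  with equality at \<open>i = 2\<close>.
\<close>

lemma P_succ_0_le:
  assumes "l > 0"
  shows "P_succ 0 l \<le> 3 / l"
proof -
  let ?f = "\<lambda>i. 2 / real i * poisson_weight l i"
  let ?g = "\<lambda>i. 3 * (poisson_weight l i / (real i + 1))"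
  note v = poisson_inverse_Suc_bound[OF assms]
  have g: "?g summable_on A" for A
    by (rule summable_on_subset_banach[OF summable_on_cmult_right[OF v(1)]]) simp
  have f_le: "?f i \<le> ?g i" if "i \<ge> 3" for i
  proof -
    have "2 / real i * poisson_weight l i \<le> 3 / (real i + 1) * poisson_weight l i"
      using that assms by (intro mult_right_mono poisson_weight_nonneg) (auto simp: field_simps)
    then show ?thesis
      by simp
  qed
  have f: "?f summable_on {3..}"
    by (rule summable_on_comparison_test[OF g[of "{3..}"]])
       (use f_le assms in \<open>auto simp: poisson_weight_nonneg\<close>)
  have "P_succ 0 l = poisson_weight l 1 + poisson_weight l 2 + infsum ?f {3..}"
    by (simp add: P_succ_def poisson_weight_def exp_minus field_simps)
  also have "poisson_weight l 1 + poisson_weight l 2 \<le> sum ?g {1, 2}"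
    using assms by (simp add: poisson_weight_nonneg)
  also have "infsum ?f {3..} \<le> infsum ?g {3..}"
    using f_le by (intro infsum_mono f g) auto
  also have "sum ?g {1, 2} + infsum ?g {3..} = infsum ?g ({1, 2} \<union> {3..})"
    by (subst infsum_Un_disjoint[OF g g]) auto
  also have "\<dots> \<le> infsum ?g UNIV"
    using assms by (intro infsum_mono2 g) (auto simp: poisson_weight_nonneg)
  also have "\<dots> = 3 * (\<Sum>\<^sub>\<infinity>i. poisson_weight l i / (real i + 1))"
    by (rule infsum_cmult_right')
  also have "\<dots> \<le> 3 / l"
    using v(2) by simp
  finally show ?thesis
    by simp
qed

lemma P_succ_nat_le:
  assumes "l > 0"
  shows "P_succ (real n) l \<le> 1 / 2 + 3 / l"
proof -
  consider "n = 0" | "n = 1" | "n \<ge> 2"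
    by linarith
  then show ?thesis
  proof cases
    case 1
    then show ?thesis
      using P_succ_0_le[OF assms] by simp
  next
    case 2
    then have "P_succ (real n) l \<le> P_succ 0 l"
      using assms by (simp add: P_succ_def)
    then show ?thesis
      using P_succ_0_le[OF assms] by simp
  next
    case 3
    then have "P_succ (real n) l \<le> 1 / 2 + 1 / l"
      using assms by (intro P_succ_le) auto
    also have "1 / l \<le> 3 / l"
      using assms by (intro divide_right_mono) auto
    finally show ?thesis
      by simp
  qed
qed

text \<open>
  Rounding \<open>l / 2\<close> down changes \<open>2 r\<close> by less than \<open>2\<close>, which is absorbed by the variance term \<open>l\<close>
  of the lower bound.
\<close>

lemma P_succ_floor_half_ge:
  assumes "l \<ge> 6"
  shows "1 / 2 - (l + 4) / (2 * (l / 2 - 1)\<^sup>2) \<le> P_succ (real (nat \<lfloor>l / 2\<rfloor>)) l"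
proof -
  define r where "r = real (nat \<lfloor>l / 2\<rfloor>)"
  have r: "r \<le> l / 2" "l / 2 - 1 \<le> r"
    unfolding r_def using assms by linarith+
  have "(l - 2 * r)\<^sup>2 \<le> 2\<^sup>2"
    using r by (intro power_mono) auto
  then have "(l + (l - 2 * r)\<^sup>2) / (2 * r\<^sup>2) \<le> (l + 4) / (2 * (l / 2 - 1)\<^sup>2)"
    using r assms by (intro frac_le mult_left_mono power_mono) auto
  moreover have "1 / 2 - (l + (l - 2 * r)\<^sup>2) / (2 * r\<^sup>2) \<le> P_succ r l"
    using r assms by (intro P_succ_ge) auto
  ultimately show ?thesis
    unfolding r_def by linarith
qed

section \<open>The limits\<close>

theorem theorem5:
  fixes m :: "real \<Rightarrow> nat" and PP :: "real \<Rightarrow> real"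
  assumes m_max: "\<And>l n. l > 0 \<Longrightarrow> P_succ (real n) l \<le> P_succ (real (m l)) l"
    and PP_eq: "\<And>l. l > 0 \<Longrightarrow> PP l = P_succ (real (m l)) l"
  shows "((\<lambda>l. P_succ (l / 2) l) \<longlongrightarrow> 1 / 2) at_top
    \<and> ((\<lambda>l. P_succ (real (m l)) l) \<longlongrightarrow> 1 / 2) at_top
    \<and> (PP \<longlongrightarrow> 1 / 2) at_top"
proof (intro conjI)
  show "((\<lambda>l. P_succ (l / 2) l) \<longlongrightarrow> 1 / 2) at_top"
  proof (rule tendsto_sandwich)
    show "\<forall>\<^sub>F l in at_top. 1 / 2 - (l + (l - 2 * (l / 2))\<^sup>2) / (2 * (l / 2)\<^sup>2) \<le> P_succ (l / 2) l"
      using eventually_ge_at_top[of 4] by eventually_elim (rule P_succ_ge, auto)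
    show "\<forall>\<^sub>F l in at_top. P_succ (l / 2) l \<le> 1 / 2 + 1 / l"
      using eventually_ge_at_top[of 4] by eventually_elim (rule P_succ_le, auto)
    show "((\<lambda>l::real. 1 / 2 - (l + (l - 2 * (l / 2))\<^sup>2) / (2 * (l / 2)\<^sup>2)) \<longlongrightarrow> 1 / 2) at_top"
      by real_asymp
    show "((\<lambda>l::real. 1 / 2 + 1 / l) \<longlongrightarrow> 1 / 2) at_top"
      by real_asymp
  qed
  show opt: "((\<lambda>l. P_succ (real (m l)) l) \<longlongrightarrow> 1 / 2) at_top"
  proof (rule tendsto_sandwich)
    show "\<forall>\<^sub>F l in at_top. 1 / 2 - (l + 4) / (2 * (l / 2 - 1)\<^sup>2) \<le> P_succ (real (m l)) l"
      using eventually_ge_at_top[of 6]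
      by eventually_elim (rule order_trans[OF P_succ_floor_half_ge m_max], auto)
    show "\<forall>\<^sub>F l in at_top. P_succ (real (m l)) l \<le> 1 / 2 + 3 / l"
      using eventually_gt_at_top[of 0] by eventually_elim (rule P_succ_nat_le)
    show "((\<lambda>l::real. 1 / 2 - (l + 4) / (2 * (l / 2 - 1)\<^sup>2)) \<longlongrightarrow> 1 / 2) at_top"
      by real_asymp
    show "((\<lambda>l::real. 1 / 2 + 3 / l) \<longlongrightarrow> 1 / 2) at_top"
      by real_asymp
  qed
  have "\<forall>\<^sub>F l in at_top. P_succ (real (m l)) l = PP l"
    using eventually_gt_at_top[of 0] by eventually_elim (simp add: PP_eq)
  then show "(PP \<longlongrightarrow> 1 / 2) at_top"
    using opt by (rule Lim_transform_eventually[rotated])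
qed

end
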